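(* Let $0<q<1$, $N\ge 1$ and $A,B,C\in\mathrm{End}(\mathbb{C}^N)$. Assume $C$ is diagonalizable with $\sigma(C)=\{c_1,\dots,c_N\}$, $c_i\neq c_j$ for $i\neq j$, and $c_i\neq 0$ for all $i$. Let $f_i\neq 0$ be corresponding eigenvectors, $Cf_i=c_if_i$, $1\le i\le N$. Assume furthermore that $\sigma(C)\cap q^{\mathbb{Z}}=\emptyset$ and that $c_i/c_j\notin q^{\mathbb{Z}}$ for $i\neq j$. Then, for any basis $\{e_1,\dots,e_N\}$ of $\mathbb{C}^N$, the vector-valued functions $$ {}_2\Phi_1(A,B;C;q,z)\,e_i,\qquad 1\le i\le N, $$ together with the vector-valued functions $$ z^{1-\log_q(c_i)}\;{}_2\Phi_1^{q/c_i}(A,B;C;q,z)\,f_i,\qquad 1\le i\le N, $$ span, over the $q$-periodic functions, the solution space of the vector-valued basic hypergeometric $q$-difference equation $$ (q-z)f(q^{-1}z)+\bigl((A+B)z-C-q\,\mathrm{Id}\bigr)f(z)+(C-ABz)f(qz)=0 $$ for the unknown $\mathbb{C}^N$-valued function $f$.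
   Context: $\sigma(M)$ denotes the set of eigenvalues of a matrix $M$; $q^{\mathbb{Z}}=\{q^k: k\in\mathbb{Z}\}$; $\mathbb{N}=\{0,1,2,\dots\}$; $(x;q)_n=\prod_{k=0}^{n-1}(1-xq^k)$. For $A,B,C\in\mathrm{End}(\mathbb{C}^N)$ with $q^{-\mathbb{N}}\cap\sigma(C)=\emptyset$ put $(A,B;C;q)_0=\mathrm{Id}$ and $$(A,B;C;q)_n=a_{n-1}a_{n-2}\cdots a_0,\qquad a_k=(\mathrm{Id}-q^kC)^{-1}(\mathrm{Id}-q^kA)(\mathrm{Id}-q^kB).$$ For $\alpha\in\mathbb{C}$ with $q^{-\mathbb{N}}\cap\sigma(\alpha C)=\emptyset$ define the matrix-valued basic hypergeometric series $${}_2\Phi_1^{\alpha}(A,B;C;q,z)=\sum_{n=0}^\infty(\alpha A,\alpha B;\alpha C;q)_n\,\frac{z^n}{(\alpha q;q)_n},\qquad {}_2\Phi_1={}_2\Phi_1^{1},$$ which converges for $|z|<1$. $\log_q(x)=\log x/\log q$ for a fixed choice of logarithm, and $z^s$ is defined with the principal branch, so that $(qz)^s=q^sz^s$. A function $p$ is $q$-periodic if $p(qz)=p(z)$. Solutions are functions $f:\{0<|z|<1\}\to\mathbb{C}^N$ satisfying the equation for $0<|z|<q$. "Span over the $q$-periodic functions" means that each listed function is a solution and every solution is a linear combination of them with $q$-periodic functions as coefficients. *)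

theory Defs
  imports "HOL-Analysis.Analysis"
begin

text \<open>
  \<open>End(\<complex>\<^sup>N)\<close> is rendered as \<open>complex^'n^'n\<close> with \<open>N = CARD('n)\<close>; families indexed by
  \<open>1, \<dots>, N\<close> become families indexed by \<open>'n\<close>.
\<close>

definition mscale :: "complex \<Rightarrow> complex^'n^'m \<Rightarrow> complex^'n^'m" (infixr \<open>*\<^sub>m\<close> 75) where
  "c *\<^sub>m M = map_matrix ((*) c) M"

definition spectrum :: "complex^'n^'n \<Rightarrow> complex set" where
  "spectrum M = {l. \<exists>v. v \<noteq> 0 \<and> M *v v = l *s v}"

definition diagonalizable :: "complex^'n^'n \<Rightarrow> bool" where
  "diagonalizable M \<longleftrightarrow>
     (\<exists>P D :: complex^'n^'n. invertible P \<and> (\<forall>i j. i \<noteq> j \<longrightarrow> D $ i $ j = 0) \<and> M = P ** D ** matrix_inv P)"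

definition is_basis :: "('n::finite \<Rightarrow> complex^'n) \<Rightarrow> bool" where
  "is_basis e \<longleftrightarrow> inj e \<and> vec.independent (range e) \<and> vec.span (range e) = UNIV"

definition q_powers :: "real \<Rightarrow> complex set" where
  "q_powers q = range (\<lambda>k::int. complex_of_real q powi k)"

definition q_poch :: "complex \<Rightarrow> real \<Rightarrow> nat \<Rightarrow> complex" where
  "q_poch x q n = (\<Prod>k<n. 1 - x * complex_of_real q ^ k)"

text \<open>
  \<open>(A,B;C;q)\<^sub>n\<close>, with each new factor multiplied on the left. It is meaningful only if no
  \<open>q\<^sup>-\<^sup>k\<close>, \<open>k \<in> \<nat>\<close>, is an eigenvalue of \<open>C\<close>, so that the inverses exist.
\<close>
primrec mat_q_poch ::
    "complex^'n^'n \<Rightarrow> complex^'n^'n \<Rightarrow> complex^'n^'n \<Rightarrow> real \<Rightarrow> nat \<Rightarrow> complex^'n^'n" where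
  "mat_q_poch A B C q 0 = mat 1"
| "mat_q_poch A B C q (Suc k) =
     (matrix_inv (mat 1 - complex_of_real q ^ k *\<^sub>m C)
       ** (mat 1 - complex_of_real q ^ k *\<^sub>m A)
       ** (mat 1 - complex_of_real q ^ k *\<^sub>m B))
     ** mat_q_poch A B C q k"

definition Phi21_gen :: "complex \<Rightarrow> complex^'n^'n \<Rightarrow> complex^'n^'n \<Rightarrow> complex^'n^'n
    \<Rightarrow> real \<Rightarrow> complex \<Rightarrow> complex^'n^'n" where
  "Phi21_gen \<alpha> A B C q z =
     (\<Sum>n. (z ^ n / q_poch (\<alpha> * complex_of_real q) q n)
            *\<^sub>m mat_q_poch (\<alpha> *\<^sub>m A) (\<alpha> *\<^sub>m B) (\<alpha> *\<^sub>m C) q n)"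

definition Phi21 :: "complex^'n^'n \<Rightarrow> complex^'n^'n \<Rightarrow> complex^'n^'n
    \<Rightarrow> real \<Rightarrow> complex \<Rightarrow> complex^'n^'n" where
  "Phi21 = Phi21_gen 1"

text \<open>
  \<open>L\<close> is an arbitrary choice of complex logarithm away from \<open>0\<close>, while \<open>log q\<close> for the positive
  real \<open>q\<close> is the real logarithm. Hence \<open>of_real q powr log_q L q x = x\<close> for \<open>x \<noteq> 0\<close> and every choice of \<open>L\<close>.
\<close>
definition is_log_choice :: "(complex \<Rightarrow> complex) \<Rightarrow> bool" where
  "is_log_choice L \<longleftrightarrow> (\<forall>x. x \<noteq> 0 \<longrightarrow> exp (L x) = x)"

definition log_q :: "(complex \<Rightarrow> complex) \<Rightarrow> real \<Rightarrow> complex \<Rightarrow> complex" where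
  "log_q L q x = L x / complex_of_real (ln q)"

definition q_periodic :: "real \<Rightarrow> (complex \<Rightarrow> complex) \<Rightarrow> bool" where
  "q_periodic q p \<longleftrightarrow> (\<forall>z. p (complex_of_real q * z) = p z)"

text \<open>
  Solutions live on \<open>0 < |z| < 1\<close>: for \<open>0 < |z| < q\<close> the equation evaluates \<open>f\<close> only at points
  of this punctured disc, and the values of the total function \<open>f\<close> elsewhere are irrelevant.
\<close>
definition q_hyp_solution :: "complex^'n^'n \<Rightarrow> complex^'n^'n \<Rightarrow> complex^'n^'n
    \<Rightarrow> real \<Rightarrow> (complex \<Rightarrow> complex^'n) \<Rightarrow> bool" where
  "q_hyp_solution A B C q f \<longleftrightarrow>
     (\<forall>z. 0 < norm z \<and> norm z < q \<longrightarrow>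
        (complex_of_real q - z) *s f (z / complex_of_real q)
        + (z *\<^sub>m (A + B) - C - complex_of_real q *\<^sub>m mat 1) *v f z
        + (C - z *\<^sub>m (A ** B)) *v f (complex_of_real q * z) = 0)"

text \<open>
  The functions \<open>F i\<close> span the solutions \<open>Sol\<close> on the punctured unit disc over the
  \<open>q\<close>-periodic functions.
\<close>
definition spans_over_q_periodic ::
    "real \<Rightarrow> ('i::finite \<Rightarrow> complex \<Rightarrow> complex^'n) \<Rightarrow> ((complex \<Rightarrow> complex^'n) \<Rightarrow> bool) \<Rightarrow> bool" where
  "spans_over_q_periodic q F Sol \<longleftrightarrow>
     (\<forall>i. Sol (F i)) \<and>
     (\<forall>g. Sol g \<longrightarrow>
        (\<exists>p. (\<forall>i. q_periodic q (p i)) \<and>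
             (\<forall>z. 0 < norm z \<and> norm z < 1 \<longrightarrow> g z = (\<Sum>i\<in>UNIV. p i z *s F i z))))"

end

theory Submission
  imports Defs
begin

text \<open>
  Inserting \<open>z\<^sup>s \<Sum> z\<^sup>n u\<^sub>n\<close> with \<open>q\<^sup>s = \<alpha>\<close> into the equation gives, with \<open>X = \<alpha> q\<^sup>n\<close>, the
  coefficient condition
  \<open>(1 - q X) (1 - X C) u\<^sub>n\<^sub>+\<^sub>1 = (1 - X A) (1 - X B) u\<^sub>n\<close> and the indicial condition
  \<open>(1 - \<alpha>) (q - \<alpha> C) u\<^sub>0 = 0\<close>. The latter holds either for \<open>\<alpha> = 1\<close> and any \<open>u\<^sub>0\<close>, or for
  \<open>\<alpha> = q / c\<close> and \<open>u\<^sub>0\<close> an eigenvector of \<open>C\<close> for \<open>c\<close>; these are the two families. The conditions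
  on the spectrum of \<open>C\<close> keep the left factors invertible, and since those factors and the right
  ones tend to the identity, the ratio test gives convergence for \<open>|z| < 1\<close>. All of this is
  treated once for general \<open>\<alpha>\<close> (\<open>Phi21_coeff_recurrence\<close>, \<open>hyp_recurrence_summable\<close>,
  \<open>hyp_series_solution\<close>).

  For the spanning property, fix an orbit \<open>{z q\<^sup>k}\<close>. On it the equation is a second-order recurrence
  for vectors. Backwards it can always be solved for \<open>f (z / q)\<close>, because \<open>|z| < q\<close>. Forwards one
  has to invert \<open>C - z A B\<close>, which may be singular, but not for small \<open>z\<close>, because \<open>C\<close> is invertible.
  So two consecutive values sufficiently close to \<open>0\<close> determine a solution on the whole part of the
  orbit inside the disc (\<open>q_hyp_solution_vanishes_on_orbit\<close>). It remains to match two such values by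
  the \<open>2 N\<close> series solutions, that is, to show that their Casoratian matrix is invertible near \<open>0\<close>.
  After the powers \<open>z\<^sup>s\<close> are divided out it has the limit
  \<open>[[E, G], [E, G D]]\<close>, where \<open>E\<close> has columns \<open>e\<^sub>i\<close>, \<open>G\<close> has columns \<open>f\<^sub>i\<close> and
  \<open>D = diag (q / c\<^sub>i)\<close>. Subtracting the block rows reduces its invertibility to that of \<open>E\<close>, \<open>G\<close> and
  \<open>1 - D\<close>. The matching coefficients are constant along each orbit, so choosing them orbit by orbit
  yields \<open>q\<close>-periodic functions (\<open>spans_if_nonzero_limit_Casoratian\<close>).
\<close>

section \<open>Matrix and vector preliminaries\<close>

lemma mscale_nth [simp]: "(c *\<^sub>m M) $ i $ j = c * M $ i $ j"
  by (simp add: mscale_def)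

lemma mscale_mult_vec: "(c *\<^sub>m M) *v x = c *s (M *v x)"
  by (simp add: vec_eq_iff matrix_vector_mult_def sum_distrib_left mult.assoc)

lemma mscale_mscale: "a *\<^sub>m (b *\<^sub>m M) = (a * b) *\<^sub>m M"
  by (simp add: vec_eq_iff mult.assoc)

lemma norm_smult_complex: "norm (c *s x) = norm c * norm (x :: complex^'n)"
  by (simp add: norm_vec_def norm_mult L2_set_right_distrib)

lemma bounded_linear_smult_complex: "bounded_linear (\<lambda>x :: complex^'n. c *s x)"
proof -
  have "(*v) (c *\<^sub>m mat 1 :: complex^'n^'n) = (*s) c"
    by (simp add: fun_eq_iff mscale_mult_vec)
  then show ?thesis
    by (metis matrix_vector_mul_bounded_linear)
qed

lemma bounded_linear_apply_vec: "bounded_linear (\<lambda>M :: complex^'n^'m. M *v x)"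
proof -
  have "linear (\<lambda>M :: complex^'n^'m. M *v x)"
    by (rule linearI) (simp_all add: vec_eq_iff matrix_vector_mult_def distrib_right sum.distrib
        scaleR_sum_right)
  then show ?thesis
    by (simp add: linear_conv_bounded_linear)
qed

text \<open>
  The series \<open>Phi21_gen\<close> sums matrices while the estimates below are for vectors; this transfers
  convergence from the latter to the former.
\<close>
lemma summable_matrix_if_columns:
  fixes M :: "nat \<Rightarrow> complex^'n^'m"
  assumes "\<And>v. summable (\<lambda>n. M n *v v)"
  shows "summable M"
proof -
  have entry: "(\<lambda>k. (\<Sum>n<k. M n) $ i $ j) \<longlonglongrightarrow> suminf (\<lambda>n. M n *v axis j 1) $ i" for i j
  proof -
    have "(\<lambda>k. (\<Sum>n<k. M n *v axis j 1) $ i) \<longlonglongrightarrow> suminf (\<lambda>n. M n *v axis j 1) $ i"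
      by (intro tendsto_vec_nth summable_LIMSEQ assms)
    moreover have "(M n *v axis j 1) $ i = M n $ i $ j" for n
      by (simp add: matrix_vector_mult_def axis_def if_distrib cong: if_cong)
    ultimately show ?thesis
      by simp
  qed
  have "(\<lambda>k. \<Sum>n<k. M n) \<longlonglongrightarrow> (\<chi> i j. suminf (\<lambda>n. M n *v axis j 1) $ i)"
    by (intro vec_tendstoI) (simp add: entry del: sum_component)
  then show ?thesis
    by (auto simp: summable_def sums_def)
qed

lemma tendsto_det:
  fixes M :: "'a \<Rightarrow> complex^'n^'n"
  assumes "\<And>i j. ((\<lambda>z. M z $ i $ j) \<longlongrightarrow> M0 $ i $ j) F"
  shows "((\<lambda>z. det (M z)) \<longlongrightarrow> det M0) F"
  unfolding det_def by (intro tendsto_sum tendsto_mult tendsto_prod tendsto_const assms)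

lemma det_nonzero_iff_trivial_kernel:
  fixes M :: "complex^'n^'n"
  shows "det M \<noteq> 0 \<longleftrightarrow> (\<forall>x. M *v x = 0 \<longrightarrow> x = 0)"
  by (metis invertible_det_nz invertible_left_inverse matrix_left_invertible_ker)

text \<open>
  Applying \<open>M - c\<^sub>k\<close> to a vanishing combination removes the \<open>k\<close>-th vector and multiplies every other
  coefficient by the nonzero number \<open>c\<^sub>i - c\<^sub>k\<close>, so the claim follows by induction.
\<close>
lemma eigenvectors_independent:
  fixes M :: "complex^'n^'n"
  assumes "finite S" and "inj_on c S"
    and "\<And>i. i \<in> S \<Longrightarrow> M *v f i = c i *s f i" and "\<And>i. i \<in> S \<Longrightarrow> f i \<noteq> 0"
    and "(\<Sum>i\<in>S. b i *s f i) = 0"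
  shows "\<forall>i\<in>S. b i = 0"
  using assms
proof (induction S arbitrary: b rule: finite_induct)
  case empty
  then show ?case by simp
next
  case (insert k S)
  have "(\<Sum>i\<in>S. (b i * (c i - c k)) *s f i)
      = (\<Sum>i\<in>insert k S. b i *s (M *v f i) - (c k * b i) *s f i)"
    using insert by (simp add: vec_eq_iff algebra_simps cong: sum.cong)
  also have "\<dots> = M *v (\<Sum>i\<in>insert k S. b i *s f i) - c k *s (\<Sum>i\<in>insert k S. b i *s f i)"
    by (simp only: sum_subtractf vec.linear_sum[OF matrix_vector_mul_linear_gen]
        vector_scalar_commute vec.scale_sum_right vector_smult_assoc)
  also have "\<dots> = 0"
    unfolding insert.prems(4) by simp
  finally have "\<forall>i\<in>S. b i * (c i - c k) = 0"
    using insert.prems by (intro insert.IH) auto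
  then have S: "\<forall>i\<in>S. b i = 0"
    using insert.prems(1) insert.hyps by (auto simp: inj_on_def)
  with insert.prems(4) insert.hyps have "b k *s f k = 0"
    by simp
  with insert.prems(3)[of k] S show ?case
    by simp
qed

section \<open>Coefficient recurrence and convergence\<close>

text \<open>
  The condition on the coefficients of \<open>z\<^sup>s \<Sum> z\<^sup>n u\<^sub>n\<close>, where \<open>q\<^sup>s = \<alpha>\<close>, for solving the equation beyond the
  lowest order. It is stated without inverses, so that norm estimates need only the perturbations of
  the identity on the two sides.
\<close>
definition hyp_recurrence where
  "hyp_recurrence \<alpha> A B C q u \<longleftrightarrow>
     (\<forall>n. (1 - \<alpha> * complex_of_real q ^ Suc n)
             *s ((mat 1 - (\<alpha> * complex_of_real q ^ n) *\<^sub>m C) *v u (Suc n))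
        = (mat 1 - (\<alpha> * complex_of_real q ^ n) *\<^sub>m A)
             *v ((mat 1 - (\<alpha> * complex_of_real q ^ n) *\<^sub>m B) *v u n))"

lemma norm_perturbed_identity:
  fixes M :: "complex^'n^'n"
  obtains K where "\<And>x v. norm ((mat 1 - x *\<^sub>m M) *v v) \<le> (1 + K * norm x) * norm v"
    and "\<And>x v. (1 - K * norm x) * norm v \<le> norm ((mat 1 - x *\<^sub>m M) *v v)"
proof -
  obtain K where K: "\<And>v. norm (M *v v) \<le> norm v * K"
    using bounded_linear.pos_bounded[OF matrix_vector_mul_bounded_linear[of M]] by blast
  have small: "norm (x *s (M *v v)) \<le> K * norm x * norm v" for x v
    using mult_left_mono[OF K[of v], of "norm x"] by (simp add: norm_smult_complex mult_ac)
  have eq: "(mat 1 - x *\<^sub>m M) *v v = v - x *s (M *v v)" for x v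
    by (simp add: matrix_vector_mult_diff_rdistrib mscale_mult_vec)
  show thesis
  proof
    fix x v
    show "norm ((mat 1 - x *\<^sub>m M) *v v) \<le> (1 + K * norm x) * norm v"
      using small[of x v] norm_triangle_ineq4[of v "x *s (M *v v)"]
      unfolding eq distrib_right by linarith
    show "(1 - K * norm x) * norm v \<le> norm ((mat 1 - x *\<^sub>m M) *v v)"
      using small[of x v] norm_triangle_ineq2[of v "x *s (M *v v)"]
      unfolding eq left_diff_distrib by linarith
  qed
qed

text \<open>
  The recurrence gives \<open>d\<^sub>n \<parallel>u\<^sub>n\<^sub>+\<^sub>1\<parallel> \<le> e\<^sub>n \<parallel>u\<^sub>n\<parallel>\<close> with \<open>d\<^sub>n\<close> and \<open>e\<^sub>n\<close> tending to \<open>1\<close>, since the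
  perturbations of the identity are of size \<open>q\<^sup>n\<close>. Hence the ratio test applies with any ratio
  strictly between \<open>|z|\<close> and \<open>1\<close>.
\<close>
lemma hyp_recurrence_summable:
  fixes u :: "nat \<Rightarrow> complex^'n"
  assumes q: "0 < q" "q < 1" and rec: "hyp_recurrence \<alpha> A B C q u" and z: "norm z < 1"
  shows "summable (\<lambda>n. z ^ n *s u n)"
proof -
  let ?x = "\<lambda>n. \<alpha> * complex_of_real q ^ n"
  obtain KA where KA: "\<And>x v. norm ((mat 1 - x *\<^sub>m A) *v v) \<le> (1 + KA * norm x) * norm v"
    by (rule norm_perturbed_identity[of A]) blast
  obtain KB where KB: "\<And>x v. norm ((mat 1 - x *\<^sub>m B) *v v) \<le> (1 + KB * norm x) * norm v"
    by (rule norm_perturbed_identity[of B]) blast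
  obtain KC where KC: "\<And>x v. (1 - KC * norm x) * norm v \<le> norm ((mat 1 - x *\<^sub>m C) *v v)"
    by (rule norm_perturbed_identity[of C]) blast
  define d where "d n = norm (1 - ?x (Suc n)) * (1 - KC * norm (?x n))" for n
  \<comment> \<open>The absolute value keeps the first factor nonnegative, as chaining the two upper bounds requires.\<close>
  define e where "e n = (1 + \<bar>KA\<bar> * norm (?x n)) * (1 + KB * norm (?x n))" for n
  define r where "r = (1 + norm z) / 2"
  have ratio: "d n * norm (u (Suc n)) \<le> e n * norm (u n)" for n
  proof -
    have "d n * norm (u (Suc n))
        \<le> norm (1 - ?x (Suc n)) * norm ((mat 1 - ?x n *\<^sub>m C) *v u (Suc n))"
      unfolding d_def mult.assoc by (intro mult_left_mono KC) simp
    also have "\<dots> = norm ((mat 1 - ?x n *\<^sub>m A) *v ((mat 1 - ?x n *\<^sub>m B) *v u n))"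
      using rec unfolding hyp_recurrence_def by (metis norm_smult_complex)
    also have "\<dots> \<le> (1 + KA * norm (?x n)) * norm ((mat 1 - ?x n *\<^sub>m B) *v u n)"
      by (rule KA)
    also have "\<dots> \<le> (1 + \<bar>KA\<bar> * norm (?x n)) * norm ((mat 1 - ?x n *\<^sub>m B) *v u n)"
      by (intro mult_right_mono add_left_mono) auto
    also have "\<dots> \<le> (1 + \<bar>KA\<bar> * norm (?x n)) * ((1 + KB * norm (?x n)) * norm (u n))"
      by (intro mult_left_mono KB) auto
    finally show ?thesis
      by (simp add: e_def mult.assoc)
  qed
  have x0: "?x \<longlonglongrightarrow> 0"
    using q by (intro tendsto_mult_right_zero LIMSEQ_power_zero) simp
  have d: "d \<longlonglongrightarrow> norm (1 - 0 :: complex) * (1 - KC * norm (0 :: complex))"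
    unfolding d_def by (intro tendsto_intros LIMSEQ_Suc[OF x0] x0)
  have e: "e \<longlonglongrightarrow> (1 + \<bar>KA\<bar> * norm (0 :: complex)) * (1 + KB * norm (0 :: complex))"
    unfolding e_def by (intro tendsto_intros x0)
  have gap: "(\<lambda>n. r * d n - norm z * e n) \<longlonglongrightarrow> r - norm z"
    using tendsto_diff[OF tendsto_mult_left[OF d, of r] tendsto_mult_left[OF e, of "norm z"]]
    by simp
  have r: "0 < r - norm z" "0 \<le> r" "r < 1"
    using z norm_ge_zero[of z] by (auto simp: r_def)
  have "\<forall>\<^sub>F n in sequentially. 0 < r * d n - norm z * e n"
    by (rule order_tendstoD(1)[OF gap r(1)])
  moreover have "\<forall>\<^sub>F n in sequentially. 0 < d n"
    using d by (intro order_tendstoD) auto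
  ultimately have "\<forall>\<^sub>F n in sequentially. 0 < d n \<and> norm z * e n \<le> r * d n"
    by eventually_elim simp
  then obtain N where N: "\<And>n. n \<ge> N \<Longrightarrow> 0 < d n \<and> norm z * e n \<le> r * d n"
    by (auto simp: eventually_sequentially)
  show ?thesis
  proof (rule summable_ratio_test[OF r(3)])
    fix n assume "N \<le> n"
    note n = N[OF this]
    have "d n * norm (z ^ Suc n *s u (Suc n)) = norm z ^ Suc n * (d n * norm (u (Suc n)))"
      by (simp add: norm_smult_complex norm_mult norm_power)
    also have "\<dots> \<le> norm z ^ Suc n * (e n * norm (u n))"
      by (intro mult_left_mono ratio) simp
    also have "\<dots> = (norm z * e n) * norm (z ^ n *s u n)"
      by (simp add: norm_smult_complex norm_power)
    also have "\<dots> \<le> (r * d n) * norm (z ^ n *s u n)"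
      using n by (intro mult_right_mono) auto
    finally have "d n * norm (z ^ Suc n *s u (Suc n)) \<le> d n * (r * norm (z ^ n *s u n))"
      by (simp only: mult_ac)
    with n show "norm (z ^ Suc n *s u (Suc n)) \<le> r * norm (z ^ n *s u n)"
      by (metis mult_le_cancel_left_pos)
  qed
qed

lemma vector_power_series_tendsto_0:
  fixes u :: "nat \<Rightarrow> complex^'n"
  assumes "\<And>z. norm z < 1 \<Longrightarrow> summable (\<lambda>n. z ^ n *s u n)"
  shows "((\<lambda>z. \<Sum>n. z ^ n *s u n) \<longlongrightarrow> u 0) (at 0)"
proof (rule vec_tendstoI)
  fix i
  have comp: "summable (\<lambda>n. u n $ i * z ^ n)"
    "(\<Sum>n. z ^ n *s u n) $ i = (\<Sum>n. u n $ i * z ^ n)" if "norm z < 1" for z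
    using bounded_linear.summable[OF bounded_linear_vec_nth assms[OF that], of i]
      bounded_linear.suminf[OF bounded_linear_vec_nth assms[OF that], of i]
    by (simp_all add: mult.commute)
  have "isCont (\<lambda>z. \<Sum>n. u n $ i * z ^ n) 0"
    by (rule isCont_powser[of _ "1/2"]) (auto intro!: comp simp: norm_divide)
  then have "((\<lambda>z. \<Sum>n. u n $ i * z ^ n) \<longlongrightarrow> u 0 $ i) (at 0)"
    by (simp add: isCont_def)
  moreover have "\<forall>\<^sub>F z in at (0 :: complex). norm z < 1"
    by (auto simp: eventually_at intro!: exI[of _ 1])
  then have "\<forall>\<^sub>F z in at 0. (\<Sum>n. u n $ i * z ^ n) = (\<Sum>n. z ^ n *s u n) $ i"
    by eventually_elim (simp add: comp)
  ultimately show "((\<lambda>z. (\<Sum>n. z ^ n *s u n) $ i) \<longlongrightarrow> u 0 $ i) (at 0)"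
    by (rule Lim_transform_eventually)
qed

section \<open>Series solutions of the equation\<close>

text \<open>
  The only properties of the prefactor \<open>z\<^sup>s\<close> that matter are how it behaves under \<open>z \<mapsto> q z\<close>, so it is an
  arbitrary \<open>\<phi>\<close> multiplied by \<open>\<alpha>\<close>. After division by \<open>\<phi> (z / q)\<close>, the \<open>n\<close>-th term of the equation is
  \<open>t\<^sub>n - t\<^sub>n\<^sub>+\<^sub>1\<close>, where \<open>t\<^sub>n\<close> collects the parts without an extra factor \<open>z\<close>. The sum telescopes to \<open>t\<^sub>0\<close>,
  which vanishes by the indicial condition.
\<close>
lemma hyp_series_solution:
  fixes u :: "nat \<Rightarrow> complex^'n"
  assumes q: "0 < q" "q < 1" and \<alpha>: "\<alpha> \<noteq> 0" and rec: "hyp_recurrence \<alpha> A B C q u"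
    and indicial: "(1 - \<alpha>) *s (complex_of_real q *s u 0 - \<alpha> *s (C *v u 0)) = 0"
    and \<phi>: "\<And>z. z \<noteq> 0 \<Longrightarrow> \<phi> (complex_of_real q * z) = \<alpha> * \<phi> z"
  shows "q_hyp_solution A B C q (\<lambda>z. \<phi> z *s (\<Sum>n. z ^ n *s u n))"
  unfolding q_hyp_solution_def
proof (intro allI impI)
  fix z :: complex assume z: "0 < norm z \<and> norm z < q"
  define Q where "Q = complex_of_real q"
  define F where "F z = (\<Sum>n. z ^ n *s u n)" for z
  have Q: "Q \<noteq> 0" "norm Q = q"
    using q by (auto simp: Q_def)
  have sums: "(\<lambda>n. z ^ n *s u n) sums F z" if "norm z < 1" for z
    unfolding F_def by (intro summable_sums hyp_recurrence_summable[OF q rec] that)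
  have "norm (Q * z) < 1"
    using z q Q mult_strict_mono[of q 1 "norm z" 1] by (simp add: norm_mult)
  note S1 = sums[OF this]
  have "norm z < 1"
    using z q by simp
  note S2 = sums[OF this]
  have "norm (z / Q) < 1"
    using z q Q by (simp add: norm_divide)
  note S3 = sums[OF this]
  note bl = bounded_linear.sums[OF matrix_vector_mul_bounded_linear]
    bounded_linear.sums[OF bounded_linear_smult_complex]
  define T where "T n = (Q - z) *s ((z / Q) ^ n *s u n)
      + \<alpha> *s ((z *\<^sub>m (A + B) - C - Q *\<^sub>m mat 1) *v (z ^ n *s u n))
      + \<alpha>\<^sup>2 *s ((C - z *\<^sub>m (A ** B)) *v ((Q * z) ^ n *s u n))" for n
  define t where "t n = Q *s ((z / Q) ^ n *s u n) - \<alpha> *s ((C + Q *\<^sub>m mat 1) *v (z ^ n *s u n))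
      + \<alpha>\<^sup>2 *s (C *v ((Q * z) ^ n *s u n))" for n
  have T: "T sums ((Q - z) *s F (z / Q)
      + \<alpha> *s ((z *\<^sub>m (A + B) - C - Q *\<^sub>m mat 1) *v F z)
      + \<alpha>\<^sup>2 *s ((C - z *\<^sub>m (A ** B)) *v F (Q * z)))"
    unfolding T_def by (intro sums_add bl S1 S2 S3)
  have "summable t"
    unfolding t_def
    by (intro summable_add summable_diff bounded_linear.summable[OF bounded_linear_smult_complex]
        bounded_linear.summable[OF matrix_vector_mul_bounded_linear] S1[THEN sums_summable]
        S2[THEN sums_summable] S3[THEN sums_summable])
  then have "(\<lambda>n. t n - t (Suc n)) sums (t 0 - 0)"
    by (intro telescope_sums' summable_LIMSEQ_zero)
  moreover have "t 0 = 0"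
    using indicial unfolding t_def Q_def
    by (simp add: vec_eq_iff matrix_vector_mult_add_rdistrib mscale_mult_vec power2_eq_square
        algebra_simps)
  moreover have "T = (\<lambda>n. t n - t (Suc n))"
  proof
    fix n
    define P where "P = Q ^ n"
    define X where "X = (z / Q) ^ n"
    have pw: "z ^ n = X * P" "(Q * z) ^ n = X * P * P" "Q ^ n = P" "(z / Q) ^ n = X"
      using Q by (simp_all add: X_def P_def power_divide power_mult_distrib)
    \<comment> \<open>Both \<open>t (Suc n)\<close> and the part of \<open>T n\<close> with a factor \<open>z\<close> are, up to sign, \<open>z X\<close> times one side of the recurrence.\<close>
    have "(1 - \<alpha> * P * Q) *s ((mat 1 - (\<alpha> * P) *\<^sub>m C) *v u (Suc n))
        = (mat 1 - (\<alpha> * P) *\<^sub>m A) *v ((mat 1 - (\<alpha> * P) *\<^sub>m B) *v u n)"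
      using rec unfolding hyp_recurrence_def P_def Q_def by (simp add: mult_ac)
    then have r: "(1 - \<alpha> * P * Q) *s (u (Suc n) - (\<alpha> * P) *s (C *v u (Suc n)))
        = u n - (\<alpha> * P) *s (A *v u n) - (\<alpha> * P) *s (B *v u n)
          + (\<alpha> * P)\<^sup>2 *s (A *v (B *v u n))"
      by (simp add: vec_eq_iff matrix_vector_mult_diff_rdistrib matrix_vector_mult_diff_distrib
          mscale_mult_vec vector_scalar_commute power2_eq_square algebra_simps)
    have "t (Suc n) = (z * X) *s ((1 - \<alpha> * P * Q) *s (u (Suc n) - (\<alpha> * P) *s (C *v u (Suc n))))"
      using Q unfolding t_def power_Suc pw
      by (simp add: vec_eq_iff matrix_vector_mult_add_rdistrib mscale_mult_vec
          vector_scalar_commute power2_eq_square field_simps)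
    then have t': "t (Suc n) = (z * X) *s (u n - (\<alpha> * P) *s (A *v u n) - (\<alpha> * P) *s (B *v u n)
          + (\<alpha> * P)\<^sup>2 *s (A *v (B *v u n)))"
      unfolding r .
    show "T n = t n - t (Suc n)"
      unfolding t' unfolding T_def t_def pw
      by (simp add: vec_eq_iff matrix_vector_mult_add_rdistrib matrix_vector_mult_diff_rdistrib
          mscale_mult_vec vector_scalar_commute power2_eq_square algebra_simps
          flip: matrix_vector_mul_assoc)
  qed
  ultimately have "T sums 0"
    by simp
  with T have zero: "(Q - z) *s F (z / Q)
      + \<alpha> *s ((z *\<^sub>m (A + B) - C - Q *\<^sub>m mat 1) *v F z)
      + \<alpha>\<^sup>2 *s ((C - z *\<^sub>m (A ** B)) *v F (Q * z)) = 0"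
    by (rule sums_unique2)
  have "\<phi> (Q * z) = \<alpha> * \<phi> z" "\<phi> z = \<alpha> * \<phi> (z / Q)"
    using \<phi>[of z] \<phi>[of "z / Q"] z Q unfolding Q_def[symmetric] by auto
  then have eq: "(Q - z) *s (\<phi> (z / Q) *s F (z / Q))
      + (z *\<^sub>m (A + B) - C - Q *\<^sub>m mat 1) *v (\<phi> z *s F z)
      + (C - z *\<^sub>m (A ** B)) *v (\<phi> (Q * z) *s F (Q * z))
      = \<phi> (z / Q) *s ((Q - z) *s F (z / Q)
      + \<alpha> *s ((z *\<^sub>m (A + B) - C - Q *\<^sub>m mat 1) *v F z)
      + \<alpha>\<^sup>2 *s ((C - z *\<^sub>m (A ** B)) *v F (Q * z)))"
    by (simp add: vec_eq_iff vector_scalar_commute power2_eq_square algebra_simps)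
  show "(complex_of_real q - z) *s (\<phi> (z / complex_of_real q) *s
         (\<Sum>n. (z / complex_of_real q) ^ n *s u n))
      + (z *\<^sub>m (A + B) - C - complex_of_real q *\<^sub>m mat 1) *v (\<phi> z *s (\<Sum>n. z ^ n *s u n))
      + (C - z *\<^sub>m (A ** B)) *v (\<phi> (complex_of_real q * z) *s
         (\<Sum>n. (complex_of_real q * z) ^ n *s u n)) = 0"
    using eq unfolding zero vector_smult_rzero unfolding F_def Q_def .
qed

lemma nonsingular_right_inverse:
  fixes M :: "complex^'n^'n"
  assumes "\<And>x. M *v x = 0 \<Longrightarrow> x = 0"
  shows "M ** matrix_inv M = mat 1"
proof -
  have "invertible M"
    using assms by (metis invertible_left_inverse matrix_left_invertible_ker)
  then show ?thesis
    unfolding matrix_inv_def invertible_def by (rule someI2_ex) blast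
qed

definition Phi21_coeff where
  "Phi21_coeff \<alpha> A B C q v n = (1 / q_poch (\<alpha> * complex_of_real q) q n)
     *s (mat_q_poch (\<alpha> *\<^sub>m A) (\<alpha> *\<^sub>m B) (\<alpha> *\<^sub>m C) q n *v v)"

lemma Phi21_coeff_0: "Phi21_coeff \<alpha> A B C q v 0 = v"
  by (simp add: Phi21_coeff_def q_poch_def)

lemma Phi21_coeff_recurrence:
  assumes poch: "\<And>n. \<alpha> * complex_of_real q ^ Suc n \<noteq> 1"
    and spec: "\<And>n x. (\<alpha> * complex_of_real q ^ n) *s (C *v x) = x \<Longrightarrow> x = 0"
  shows "hyp_recurrence \<alpha> A B C q (Phi21_coeff \<alpha> A B C q v)"
  unfolding hyp_recurrence_def
proof
  fix n
  define X where "X M = mat 1 - (\<alpha> * complex_of_real q ^ n) *\<^sub>m M" for M :: "complex^'a^'a"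
  define Y where "Y = mat_q_poch (\<alpha> *\<^sub>m A) (\<alpha> *\<^sub>m B) (\<alpha> *\<^sub>m C) q n *v v"
  define p where "p = q_poch (\<alpha> * complex_of_real q) q n"
  have inv: "X C ** matrix_inv (X C) = mat 1"
  proof (rule nonsingular_right_inverse)
    fix x assume "X C *v x = 0"
    then show "x = 0"
      using spec[of n x] by (simp add: X_def matrix_vector_mult_diff_rdistrib mscale_mult_vec)
  qed
  have step: "Phi21_coeff \<alpha> A B C q v (Suc n) = (1 / (p * (1 - \<alpha> * complex_of_real q ^ Suc n)))
      *s (matrix_inv (X C) *v (X A *v (X B *v Y)))"
    unfolding Phi21_coeff_def X_def Y_def p_def
    by (simp add: q_poch_def mscale_mscale mult_ac flip: matrix_vector_mul_assoc)
  have "X C *v (matrix_inv (X C) *v w) = w" for w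
    using inv by (simp add: matrix_vector_mul_assoc)
  then have "(1 - \<alpha> * complex_of_real q ^ Suc n) *s (X C *v Phi21_coeff \<alpha> A B C q v (Suc n))
      = (1 / p) *s (X A *v (X B *v Y))"
    using poch[of n] unfolding step by (simp add: vector_scalar_commute)
  also have "\<dots> = X A *v (X B *v Phi21_coeff \<alpha> A B C q v n)"
    by (simp add: Phi21_coeff_def Y_def p_def vector_scalar_commute)
  finally show "(1 - \<alpha> * complex_of_real q ^ Suc n)
        *s ((mat 1 - (\<alpha> * complex_of_real q ^ n) *\<^sub>m C) *v Phi21_coeff \<alpha> A B C q v (Suc n))
      = (mat 1 - (\<alpha> * complex_of_real q ^ n) *\<^sub>m A)
        *v ((mat 1 - (\<alpha> * complex_of_real q ^ n) *\<^sub>m B) *v Phi21_coeff \<alpha> A B C q v n)"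
    unfolding X_def .
qed

lemma Phi21_gen_mult_vec:
  fixes A B C :: "complex^'n^'n"
  assumes "0 < q" "q < 1" "norm z < 1"
    and "\<And>n. \<alpha> * complex_of_real q ^ Suc n \<noteq> 1"
    and "\<And>n x. (\<alpha> * complex_of_real q ^ n) *s (C *v x) = x \<Longrightarrow> x = 0"
  shows "Phi21_gen \<alpha> A B C q z *v v = (\<Sum>n. z ^ n *s Phi21_coeff \<alpha> A B C q v n)"
proof -
  let ?M = "\<lambda>n. (z ^ n / q_poch (\<alpha> * complex_of_real q) q n)
            *\<^sub>m mat_q_poch (\<alpha> *\<^sub>m A) (\<alpha> *\<^sub>m B) (\<alpha> *\<^sub>m C) q n"
  have summand: "?M n *v w = z ^ n *s Phi21_coeff \<alpha> A B C q w n" for n w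
    by (simp add: Phi21_coeff_def mscale_mult_vec)
  have "summable ?M"
    by (rule summable_matrix_if_columns)
      (simp only: summand hyp_recurrence_summable[OF assms(1,2) Phi21_coeff_recurrence[OF assms(4,5)] assms(3)])
  then show ?thesis
    unfolding Phi21_gen_def
    by (subst bounded_linear.suminf[OF bounded_linear_apply_vec]) (simp_all only: summand)
qed

section \<open>Solutions along a q-orbit\<close>

lemma q_hyp_solution_lincomb:
  assumes "q_hyp_solution A B C q g" and "q_hyp_solution A B C q h"
  shows "q_hyp_solution A B C q (\<lambda>z. g z + a *s h z)"
  unfolding q_hyp_solution_def
proof (intro allI impI)
  fix z :: complex assume z: "0 < norm z \<and> norm z < q"
  let ?E = "\<lambda>g. (complex_of_real q - z) *s g (z / complex_of_real q)
        + (z *\<^sub>m (A + B) - C - complex_of_real q *\<^sub>m mat 1) *v g z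
        + (C - z *\<^sub>m (A ** B)) *v g (complex_of_real q * z)"
  have "?E (\<lambda>z. g z + a *s h z) = ?E g + a *s ?E h"
    by (simp add: vec_eq_iff matrix_vector_right_distrib vector_scalar_commute algebra_simps)
  also have "\<dots> = 0"
    using assms z by (simp add: q_hyp_solution_def)
  finally show "?E (\<lambda>z. g z + a *s h z) = 0" .
qed

lemma q_hyp_solution_diff_sum:
  assumes "finite S" and "q_hyp_solution A B C q g" and "\<And>j. q_hyp_solution A B C q (F j)"
  shows "q_hyp_solution A B C q (\<lambda>z. g z - (\<Sum>j\<in>S. a j *s F j z))"
  using assms(1)
proof induction
  case empty
  then show ?case using assms(2) by simp
next
  case (insert k S)
  have "(\<lambda>z. g z - (\<Sum>j\<in>insert k S. a j *s F j z))
      = (\<lambda>z. (g z - (\<Sum>j\<in>S. a j *s F j z)) + (- a k) *s F k z)"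
    using insert.hyps by (simp add: fun_eq_iff vec_eq_iff)
  then show ?case
    by (simp only: q_hyp_solution_lincomb[OF insert.IH assms(3)])
qed

text \<open>
  Uniqueness for the recurrence on an orbit: from two consecutive zeros, the steps towards \<open>0\<close> stay
  in the region where \<open>C - z A B\<close> is invertible, and the steps away from \<open>0\<close> divide only by \<open>q - z\<close>,
  which is nonzero for \<open>|z| < q\<close>.
\<close>
lemma q_hyp_solution_vanishes_on_orbit:
  fixes A B C :: "complex^'n^'n"
  assumes q: "0 < q" "q < 1" and h: "q_hyp_solution A B C q h"
    and regular: "\<And>z. 0 < norm z \<Longrightarrow> norm z < \<delta> \<Longrightarrow> det (C - z *\<^sub>m (A ** B)) \<noteq> 0"
    and w: "0 < norm w" "norm w < \<delta>" "norm w < 1"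
    and zero: "h w = 0" "h (complex_of_real q * w) = 0"
    and k: "norm (w * complex_of_real q powi k) < 1"
  shows "h (w * complex_of_real q powi k) = 0"
proof -
  define Q where "Q = complex_of_real q"
  have Q: "Q \<noteq> 0" "norm Q = q"
    using q by (auto simp: Q_def)
  have eq: "(Q - z) *s h (z / Q) + (z *\<^sub>m (A + B) - C - Q *\<^sub>m mat 1) *v h z
      + (C - z *\<^sub>m (A ** B)) *v h (Q * z) = 0" if "0 < norm z" "norm z < q" for z
    using h that unfolding q_hyp_solution_def Q_def by blast
  have forward: "h (w * Q ^ n) = 0 \<and> h (w * Q ^ Suc n) = 0" for n
  proof (induction n)
    case 0
    then show ?case using zero by (simp add: Q_def mult.commute)
  next
    case (Suc n)
    let ?z = "w * Q ^ Suc n"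
    have norm_z: "norm ?z = norm w * q * q ^ n"
      using Q by (simp add: norm_mult norm_power)
    have "norm w * q * q ^ n \<le> norm w * q * 1"
      using q by (intro mult_left_mono power_le_one) auto
    moreover have "norm w * q < 1 * q" "norm w * q \<le> norm w * 1"
      using q w by (auto intro!: mult_strict_right_mono mult_left_mono simp del: mult_1 mult_1_right)
    moreover have "0 < norm ?z"
      using w Q by simp
    ultimately have z: "0 < norm ?z" "norm ?z < q" "norm ?z < \<delta>"
      using w unfolding norm_z by linarith+
    have shift: "?z / Q = w * Q ^ n" "Q * ?z = w * Q ^ Suc (Suc n)"
      using Q by simp_all
    have "(C - ?z *\<^sub>m (A ** B)) *v h (w * Q ^ Suc (Suc n)) = 0"
      using eq[OF z(1,2)] Suc.IH unfolding shift by simp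
    with regular[OF z(1,3)] Suc.IH show ?case
      by (simp add: det_nonzero_iff_trivial_kernel)
  qed
  have backward: "norm (w / Q ^ n) < 1 \<longrightarrow> h (w / Q ^ n) = 0 \<and> h (Q * (w / Q ^ n)) = 0" for n
  proof (induction n)
    case 0
    then show ?case using zero by (simp add: Q_def)
  next
    case (Suc n)
    let ?z = "w / Q ^ n"
    show ?case
    proof
      assume next_in_disc: "norm (w / Q ^ Suc n) < 1"
      have "norm ?z = q * norm (w / Q ^ Suc n)"
        using Q q by (simp add: norm_divide norm_mult)
      also have "\<dots> < q * 1"
        using q(1) next_in_disc by (rule mult_strict_left_mono[rotated])
      finally have "norm ?z < q"
        by simp
      moreover have "0 < norm ?z"
        using w Q by simp
      ultimately have z: "norm ?z < q" "0 < norm ?z" .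
      have "norm ?z < 1"
        using z q by linarith
      then have "h ?z = 0" "h (Q * ?z) = 0"
        using Suc.IH by blast+
      moreover have "Q - ?z \<noteq> 0"
        using z Q by auto
      moreover have shift: "?z / Q = w / Q ^ Suc n" "Q * (w / Q ^ Suc n) = ?z"
        using Q by simp_all
      ultimately show "h (w / Q ^ Suc n) = 0 \<and> h (Q * (w / Q ^ Suc n)) = 0"
        using eq[OF z(2,1)] unfolding shift by simp
    qed
  qed
  show ?thesis
  proof (cases "k \<ge> 0")
    case True
    then obtain n where "k = int n"
      by (rule nonneg_int_cases)
    then show ?thesis
      using forward[of n] by (simp add: Q_def)
  next
    case False
    then obtain n where n: "k = - int n"
      by (metis linear nonpos_int_cases)
    have "w * complex_of_real q powi k = w / Q ^ n"
      by (simp add: n Q_def power_int_minus divide_inverse)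
    then show ?thesis
      using backward[of n] k by simp
  qed
qed

text \<open>
  The equation at \<open>0 < |z| < q\<close> looks only at points of the unit disc, so a family may be
  modified outside of it. This allows the matrix series to be replaced by vector series, which agree
  with them where both converge.
\<close>
lemma spans_over_q_periodic_cong:
  fixes F G :: "'i::finite \<Rightarrow> complex \<Rightarrow> complex^'n"
  assumes q: "0 < q" "q < 1"
    and eq: "\<And>j z. norm z < 1 \<Longrightarrow> F j z = G j z"
    and G: "spans_over_q_periodic q G (q_hyp_solution A B C q)"
  shows "spans_over_q_periodic q F (q_hyp_solution A B C q)"
proof -
  have "q_hyp_solution A B C q (F j)" for j
    unfolding q_hyp_solution_def
  proof (intro allI impI)
    fix z :: complex assume z: "0 < norm z \<and> norm z < q"
    have "q * norm z < 1 * 1"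
      using z q by (intro mult_strict_mono) auto
    then have disc: "norm (complex_of_real q * z) < 1" "norm z < 1" "norm (z / complex_of_real q) < 1"
      using z q by (simp_all add: norm_mult norm_divide)
    moreover have "q_hyp_solution A B C q (G j)"
      using G unfolding spans_over_q_periodic_def by blast
    ultimately show "(complex_of_real q - z) *s F j (z / complex_of_real q)
        + (z *\<^sub>m (A + B) - C - complex_of_real q *\<^sub>m mat 1) *v F j z
        + (C - z *\<^sub>m (A ** B)) *v F j (complex_of_real q * z) = 0"
      using z unfolding q_hyp_solution_def eq[OF disc(1)] eq[OF disc(2)] eq[OF disc(3)] by blast
  qed
  moreover have "\<exists>p. (\<forall>i. q_periodic q (p i)) \<and>
      (\<forall>z. 0 < norm z \<and> norm z < 1 \<longrightarrow> g z = (\<Sum>i\<in>UNIV. p i z *s F i z))"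
    if sol_g: "q_hyp_solution A B C q g" for g
  proof -
    obtain p where p: "(\<forall>i. q_periodic q (p i)) \<and>
        (\<forall>z. 0 < norm z \<and> norm z < 1 \<longrightarrow> g z = (\<Sum>i\<in>UNIV. p i z *s G i z))"
      using conjunct2[OF G[unfolded spans_over_q_periodic_def], rule_format, OF sol_g] ..
    have "g z = (\<Sum>i\<in>UNIV. p i z *s F i z)" if "0 < norm z" "norm z < 1" for z
      using p that unfolding eq[OF that(2)] by simp
    with p show ?thesis
      by blast
  qed
  ultimately show ?thesis
    unfolding spans_over_q_periodic_def by blast
qed

section \<open>The Casoratian at the origin\<close>

text \<open>
  The family is indexed by \<open>'n + 'n\<close>, so that the vectors at two consecutive points of an orbit make
  up a square matrix. The factors \<open>\<phi>\<^sub>j\<close>, which need have no limit at \<open>0\<close>, are absorbed into the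
  coefficients; their only trace in the Casoratian is the multiplier \<open>\<mu>\<^sub>j\<close> in the second block row.
  The hypothesis \<open>indep\<close> is the invertibility of its limit, which persists near \<open>0\<close> by continuity of
  the determinant.
\<close>
lemma spans_if_nonzero_limit_Casoratian:
  fixes A B C :: "complex^'n^'n" and H :: "'n + 'n \<Rightarrow> complex \<Rightarrow> complex^'n"
  assumes q: "0 < q" "q < 1"
    and C: "\<And>x. C *v x = 0 \<Longrightarrow> x = 0"
    and sol: "\<And>j. q_hyp_solution A B C q (\<lambda>z. \<phi> j z *s H j z)"
    and \<phi>0: "\<And>j z. z \<noteq> 0 \<Longrightarrow> \<phi> j z \<noteq> 0"
    and \<phi>: "\<And>j z. z \<noteq> 0 \<Longrightarrow> \<phi> j (complex_of_real q * z) = \<mu> j * \<phi> j z"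
    and lim: "\<And>j. (H j \<longlongrightarrow> h j) (at 0)"
    and indep: "\<And>x. (\<Sum>j\<in>UNIV. x j *s h j) = 0 \<Longrightarrow> (\<Sum>j\<in>UNIV. (x j * \<mu> j) *s h j) = 0
        \<Longrightarrow> \<forall>j. x j = 0"
  shows "spans_over_q_periodic q (\<lambda>j z. \<phi> j z *s H j z) (q_hyp_solution A B C q)"
proof -
  define Q where "Q = complex_of_real q"
  have Q: "Q \<noteq> 0" "norm Q = q"
    using q by (auto simp: Q_def)
  define Cas :: "('n + 'n \<Rightarrow> complex^'n) \<Rightarrow> ('n + 'n \<Rightarrow> complex^'n) \<Rightarrow> complex^('n+'n)^('n+'n)"
    where "Cas a b = (\<chi> r j. case r of Inl k \<Rightarrow> a j $ k | Inr k \<Rightarrow> \<mu> j * b j $ k)" for a b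
  have Cas_mult: "Cas a b *v x = (\<chi> r. case r of
      Inl k \<Rightarrow> (\<Sum>j\<in>UNIV. x $ j *s a j) $ k | Inr k \<Rightarrow> (\<Sum>j\<in>UNIV. (x $ j * \<mu> j) *s b j) $ k)"
    for a b x
    by (simp add: Cas_def vec_eq_iff matrix_vector_mult_def mult_ac split: sum.split)
  have "det (Cas h h) \<noteq> 0"
    unfolding det_nonzero_iff_trivial_kernel
  proof (intro allI impI)
    fix x assume "Cas h h *v x = 0"
    then have "(Cas h h *v x) $ Inl k = 0 \<and> (Cas h h *v x) $ Inr k = 0" for k
      by simp
    then have "(\<Sum>j\<in>UNIV. x $ j *s h j) = 0" "(\<Sum>j\<in>UNIV. (x $ j * \<mu> j) *s h j) = 0"
      unfolding Cas_mult by (simp_all add: vec_eq_iff)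
    from indep[OF this] show "x = 0"
      by (simp add: vec_eq_iff)
  qed
  moreover have "((\<lambda>z. det (Cas (\<lambda>j. H j z) (\<lambda>j. H j (Q * z)))) \<longlongrightarrow> det (Cas h h)) (at 0)"
  proof (rule tendsto_det)
    fix r j
    have "filterlim (\<lambda>z. Q * z) (at 0) (at 0)"
    proof (rule filterlim_atI)
      show "((\<lambda>z. Q * z) \<longlongrightarrow> 0) (at 0)"
        by (auto intro!: tendsto_eq_intros)
      show "\<forall>\<^sub>F z in at 0. Q * z \<noteq> 0"
        using Q by (auto simp: eventually_at_filter)
    qed
    from filterlim_compose[OF lim this, of j]
    show "((\<lambda>z. Cas (\<lambda>j. H j z) (\<lambda>j. H j (Q * z)) $ r $ j) \<longlongrightarrow> Cas h h $ r $ j) (at 0)"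
      using lim[of j] by (auto simp: Cas_def intro!: tendsto_intros split: sum.split)
  qed
  ultimately have ev1: "\<forall>\<^sub>F z in at 0. det (Cas (\<lambda>j. H j z) (\<lambda>j. H j (Q * z))) \<noteq> 0"
    by (intro tendsto_imp_eventually_ne)
  have "((\<lambda>z. det (C - z *\<^sub>m (A ** B))) \<longlongrightarrow> det C) (at 0)"
    by (rule tendsto_det) (auto intro!: tendsto_eq_intros)
  moreover have "det C \<noteq> 0"
    using C by (simp add: det_nonzero_iff_trivial_kernel)
  ultimately have ev2: "\<forall>\<^sub>F z in at 0. det (C - z *\<^sub>m (A ** B)) \<noteq> 0"
    by (intro tendsto_imp_eventually_ne)
  obtain \<delta> where \<delta>: "\<delta> > 0"
    and Cas: "\<And>z. 0 < norm z \<Longrightarrow> norm z < \<delta> \<Longrightarrow> det (Cas (\<lambda>j. H j z) (\<lambda>j. H j (Q * z))) \<noteq> 0"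
    and regular: "\<And>z. 0 < norm z \<Longrightarrow> norm z < \<delta> \<Longrightarrow> det (C - z *\<^sub>m (A ** B)) \<noteq> 0"
    using eventually_conj[OF ev1 ev2] unfolding eventually_at by (auto simp: dist_norm)
  define F where "F j z = \<phi> j z *s H j z" for j z
  have orbit: "\<exists>a. \<forall>k::int. norm (z * Q powi k) < 1 \<longrightarrow> g (z * Q powi k) = (\<Sum>j\<in>UNIV. a j *s F j (z * Q powi k))"
    if g: "q_hyp_solution A B C q g" and z: "0 < norm z" "norm z < 1" for g z
  proof -
    \<comment> \<open>Go down the orbit to a point \<open>w\<close> so small that the Casoratian is invertible, and match there.\<close>
    have "(\<lambda>n. norm z * q ^ n) \<longlonglongrightarrow> 0"
      using q by (intro tendsto_mult_right_zero LIMSEQ_power_zero) simp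
    with \<delta> have "\<forall>\<^sub>F n in sequentially. norm z * q ^ n < \<delta>"
      by (intro order_tendstoD)
    then obtain n where n: "norm z * q ^ n < \<delta>"
      by (auto simp: eventually_sequentially)
    define w where "w = z * Q ^ n"
    have "norm z * q ^ n \<le> norm z * 1"
      using q by (intro mult_left_mono power_le_one) auto
    moreover have norm_w: "norm w = norm z * q ^ n"
      using Q by (simp add: w_def norm_mult norm_power)
    moreover have "0 < norm w"
      using z Q by (simp add: w_def)
    ultimately have w: "0 < norm w" "norm w < \<delta>" "norm w < 1"
      using n z by linarith+
    then have "w \<noteq> 0" by auto
    let ?W = "Cas (\<lambda>j. H j w) (\<lambda>j. H j (Q * w))"
    have "invertible ?W"
      using Cas[OF w(1,2)] by (simp add: invertible_det_nz)
    then obtain x where x: "?W *v x = (\<chi> r. case r of Inl k \<Rightarrow> g w $ k | Inr k \<Rightarrow> g (Q * w) $ k)"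
      by (metis invertible_def matrix_vector_mul_assoc matrix_vector_mul_lid)
    have "(?W *v x) $ Inl k = g w $ k \<and> (?W *v x) $ Inr k = g (Q * w) $ k" for k
      unfolding x by simp
    then have x1: "(\<Sum>j\<in>UNIV. x $ j *s H j w) = g w"
      and x2: "(\<Sum>j\<in>UNIV. (x $ j * \<mu> j) *s H j (Q * w)) = g (Q * w)"
      unfolding Cas_mult by (simp_all add: vec_eq_iff)
    define a where "a j = x $ j / \<phi> j w" for j
    define d where "d z = g z - (\<Sum>j\<in>UNIV. a j *s F j z)" for z
    have "q_hyp_solution A B C q d"
      unfolding d_def F_def by (rule q_hyp_solution_diff_sum[OF _ g sol]) simp
    moreover have "d w = 0"
      using \<phi>0[OF \<open>w \<noteq> 0\<close>] by (simp add: d_def F_def a_def x1)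
    moreover have "d (complex_of_real q * w) = 0"
      using \<phi>0[OF \<open>w \<noteq> 0\<close>] \<phi>[OF \<open>w \<noteq> 0\<close>] x2
      by (simp add: d_def F_def a_def Q_def)
    ultimately have "d (w * Q powi k) = 0" if "norm (w * Q powi k) < 1" for k
      using q_hyp_solution_vanishes_on_orbit[OF q _ regular w, where h = d] that
      unfolding Q_def by blast
    moreover have "z * Q powi k = w * Q powi (k - int n)" for k
      using Q by (simp add: w_def power_int_diff)
    ultimately show ?thesis
      unfolding d_def by (intro exI[of _ a]) auto
  qed
  show ?thesis
    unfolding spans_over_q_periodic_def F_def[symmetric]
  proof (intro conjI allI impI)
    show "q_hyp_solution A B C q (F j)" for j
      unfolding F_def by (rule sol)
    fix g assume g: "q_hyp_solution A B C q g"
    define good where "good z a \<longleftrightarrow> (\<forall>k::int. norm (z * Q powi k) < 1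
      \<longrightarrow> g (z * Q powi k) = (\<Sum>j\<in>UNIV. a j *s F j (z * Q powi k)))" for z a
    \<comment> \<open>The predicate \<open>good z\<close> depends only on the orbit of \<open>z\<close>, hence so does the choice, and \<open>p\<close> is periodic.\<close>
    define p where "p j z = (SOME a. good z a) j" for j z
    have all_shift: "(\<forall>k::int. P (k + 1)) \<longleftrightarrow> (\<forall>k. P k)" for P
      by (metis diff_add_cancel)
    have "good (Q * z) = good z" for z
    proof (rule ext)
      fix a
      have "Q * z * Q powi k = z * Q powi (k + 1)" for k
        using Q by (simp add: power_int_add)
      then have "good (Q * z) a \<longleftrightarrow> (\<forall>k::int. norm (z * Q powi (k + 1)) < 1
        \<longrightarrow> g (z * Q powi (k + 1)) = (\<Sum>j\<in>UNIV. a j *s F j (z * Q powi (k + 1))))"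
        by (simp only: good_def)
      also have "\<dots> \<longleftrightarrow> good z a"
        unfolding good_def by (rule all_shift)
      finally show "good (Q * z) a = good z a" .
    qed
    then have "q_periodic q (p j)" for j
      by (simp add: q_periodic_def p_def Q_def)
    moreover have "g z = (\<Sum>j\<in>UNIV. p j z *s F j z)" if "0 < norm z" "norm z < 1" for z
    proof -
      have "good z (\<lambda>j. p j z)"
        using orbit[OF g that] unfolding p_def good_def[symmetric] by (simp add: someI_ex)
      with that show ?thesis
        unfolding good_def by (auto dest: spec[of _ 0])
    qed
    ultimately show "\<exists>p. (\<forall>i. q_periodic q (p i)) \<and>
      (\<forall>z. 0 < norm z \<and> norm z < 1 \<longrightarrow> g z = (\<Sum>i\<in>UNIV. p i z *s F i z))"
      by blast
  qed
qed

section \<open>The two families of series solutions\<close>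

lemma q_power_in_q_powers: "complex_of_real q ^ n \<in> q_powers q" "1 / complex_of_real q ^ n \<in> q_powers q"
  unfolding q_powers_def by (auto intro: range_eqI[of _ _ "int n"] range_eqI[of _ _ "- int n"]
      simp: power_int_minus divide_inverse)

text \<open>
  Whatever branch \<open>L\<close> is, it enters only through \<open>exp (L c) = c\<close>; so \<open>z\<^sup>s\<close> with \<open>s = 1 - log\<^sub>q c\<close> has the
  multiplier \<open>\<alpha> = q / c\<close> demanded by the indicial condition.
\<close>
lemma q_powr_exponent:
  assumes "0 < q" "q < 1" "is_log_choice L" "c \<noteq> 0"
  shows "complex_of_real q powr (1 - log_q L q c) = complex_of_real q / c"
proof -
  have "complex_of_real (ln q) \<noteq> 0"
    using assms by simp
  then have "complex_of_real q powr (1 - log_q L q c) = exp (of_real (ln q) - L c)"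
    using assms by (simp add: powr_def log_q_def Ln_of_real algebra_simps)
  also have "\<dots> = complex_of_real q / c"
    using assms by (simp add: exp_diff is_log_choice_def exp_of_real)
  finally show ?thesis .
qed

theorem theorem8p2:
  fixes q :: real
    and A B C :: "complex^'n^'n"
    and c :: "'n \<Rightarrow> complex"
    and f e :: "'n \<Rightarrow> complex^'n"
    and L :: "complex \<Rightarrow> complex"
  assumes "0 < q" and "q < 1"
    and "is_log_choice L"
    and "diagonalizable C"
    and "spectrum C = range c"
    and "\<And>i j. i \<noteq> j \<Longrightarrow> c i \<noteq> c j"
    and "\<And>i. c i \<noteq> 0"
    and "\<And>i. f i \<noteq> 0"
    and "\<And>i. C *v f i = c i *s f i"
    and "spectrum C \<inter> q_powers q = {}"
    and "\<And>i j. i \<noteq> j \<Longrightarrow> c i / c j \<notin> q_powers q"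
    and "is_basis e"
  shows "spans_over_q_periodic q
           (case_sum
              (\<lambda>i z. Phi21 A B C q z *v e i)
              (\<lambda>i z. z powr (1 - log_q L q (c i))
                      *s (Phi21_gen (complex_of_real q / c i) A B C q z *v f i)))
           (q_hyp_solution A B C q)"
proof -
  define Q where "Q = complex_of_real q"
  have Q: "Q \<noteq> 0" "norm Q = q"
    using assms(1) by (auto simp: Q_def)
  have Q_powers: "Q ^ n \<in> q_powers q" "1 / Q ^ n \<in> q_powers q" for n
    unfolding Q_def by (rule q_power_in_q_powers)+
  have c_not_power: "c i \<notin> q_powers q" for i
    using assms(5,10) by auto
  \<comment> \<open>For \<open>\<alpha> = Q / c i\<close> this is what makes \<open>1 - \<alpha> Q\<^sup>n C\<close> nonsingular.\<close>
  have ratio: "Q ^ Suc n * c j \<noteq> c i" for n i j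
  proof (cases "i = j")
    case True
    have "norm (Q ^ Suc n) < 1"
      using Q assms(1,2) power_Suc_less_one[of q n] by (simp add: norm_power norm_mult)
    with True show ?thesis
      using assms(7)[of i] by auto
  next
    case False
    then show ?thesis
      using assms(11)[OF False] Q_powers(1)[of "Suc n"] assms(7)[of j] by (metis nonzero_mult_div_cancel_right)
  qed
  have eigen: "x \<noteq> 0 \<Longrightarrow> C *v x = l *s x \<Longrightarrow> l \<in> range c" for l x
    using assms(5) unfolding spectrum_def by blast
  have regular: "x = 0" if "\<alpha> = 1 \<or> (\<exists>i. \<alpha> = Q / c i)" "(\<alpha> * Q ^ n) *s (C *v x) = x" for \<alpha> n x
  proof (rule ccontr)
    assume "x \<noteq> 0"
    have \<alpha>: "\<alpha> * Q ^ n \<noteq> 0"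
      using that(1) Q assms(7) by auto
    have "C *v x = (1 / (\<alpha> * Q ^ n)) *s ((\<alpha> * Q ^ n) *s (C *v x))"
      by (simp only: vector_smult_assoc times_divide_eq_left mult_1_left divide_self[OF \<alpha>]
          vector_smult_lid)
    then have "C *v x = (1 / (\<alpha> * Q ^ n)) *s x"
      unfolding that(2) .
    then obtain j where j: "1 / (\<alpha> * Q ^ n) = c j"
      using eigen[OF \<open>x \<noteq> 0\<close>] by blast
    from that(1) show False
    proof
      assume "\<alpha> = 1"
      then show False
        using j Q_powers(2)[of n] c_not_power[of j] by simp
    next
      assume "\<exists>i. \<alpha> = Q / c i"
      then obtain i where i: "\<alpha> = Q / c i" ..
      have "(\<alpha> * Q ^ n) * c j = 1"
        unfolding j[symmetric] by (simp only: times_divide_eq_right mult_1_right divide_self[OF \<alpha>])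
      then have "Q ^ Suc n * c j = c i"
        using assms(7)[of i] by (simp add: i field_simps)
      with ratio show False
        by blast
    qed
  qed
  have poch: "\<alpha> * Q ^ Suc n \<noteq> 1" if "\<alpha> = 1 \<or> (\<exists>i. \<alpha> = Q / c i)" for \<alpha> n
    using that
  proof
    assume "\<alpha> = 1"
    have "norm (Q ^ Suc n) < 1"
      using Q assms(1,2) power_Suc_less_one[of q n] by (simp add: norm_power norm_mult)
    with \<open>\<alpha> = 1\<close> show ?thesis by auto
  next
    assume "\<exists>i. \<alpha> = Q / c i"
    then obtain i where i: "\<alpha> = Q / c i" ..
    show ?thesis
    proof
      assume "\<alpha> * Q ^ Suc n = 1"
      then have "Q ^ Suc (Suc n) = c i"
        using assms(7)[of i] by (simp add: i field_simps)
      then show False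
        using c_not_power[of i] Q_powers(1)[of "Suc (Suc n)"] by simp
    qed
  qed
  define \<alpha> :: "'n + 'n \<Rightarrow> complex" where "\<alpha> = case_sum (\<lambda>i. 1) (\<lambda>i. Q / c i)"
  define v where "v = case_sum e f"
  define \<phi> :: "'n + 'n \<Rightarrow> complex \<Rightarrow> complex"
    where "\<phi> = case_sum (\<lambda>i z. 1) (\<lambda>i z. z powr (1 - log_q L q (c i)))"
  define H where "H j z = (\<Sum>n. z ^ n *s Phi21_coeff (\<alpha> j) A B C q (v j) n)" for j z
  define F where "F = case_sum (\<lambda>i z. Phi21 A B C q z *v e i)
              (\<lambda>i z. z powr (1 - log_q L q (c i))
                      *s (Phi21_gen (complex_of_real q / c i) A B C q z *v f i))"
  have \<alpha>: "\<alpha> j = 1 \<or> (\<exists>i. \<alpha> j = Q / c i)" for j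
    by (cases j) (auto simp: \<alpha>_def)
  have poch_\<alpha>: "\<alpha> j * complex_of_real q ^ Suc n \<noteq> 1" for j n
    using poch[OF \<alpha>] unfolding Q_def .
  have regular_\<alpha>: "x = 0" if "(\<alpha> j * complex_of_real q ^ n) *s (C *v x) = x" for j n x
    using \<alpha> that[folded Q_def] by (rule regular)
  have rec: "hyp_recurrence (\<alpha> j) A B C q (Phi21_coeff (\<alpha> j) A B C q (v j))" for j
    by (rule Phi21_coeff_recurrence) (fact poch_\<alpha>, fact regular_\<alpha>)
  have \<phi>: "\<phi> j (Q * z) = \<alpha> j * \<phi> j z" for j z
    using assms(1) q_powr_exponent[OF assms(1-3,7)]
    by (auto simp: \<phi>_def \<alpha>_def Q_def powr_times_real_left split: sum.split)
  have spans: "spans_over_q_periodic q (\<lambda>j z. \<phi> j z *s H j z) (q_hyp_solution A B C q)"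
  proof (rule spans_if_nonzero_limit_Casoratian[OF assms(1,2)])
    show "x = 0" if "C *v x = 0" for x
      using eigen[of x 0] that assms(7) by (auto simp: image_iff)
    show "\<phi> j z \<noteq> 0" if "z \<noteq> 0" for j z
      using that by (auto simp: \<phi>_def split: sum.split)
    show "\<phi> j (complex_of_real q * z) = \<alpha> j * \<phi> j z" for j z
      using \<phi> unfolding Q_def .
    show "(H j \<longlongrightarrow> v j) (at 0)" for j
      using vector_power_series_tendsto_0[OF hyp_recurrence_summable[OF assms(1,2) rec], of j]
      unfolding H_def Phi21_coeff_0 .
    show "q_hyp_solution A B C q (\<lambda>z. \<phi> j z *s H j z)" for j
      unfolding H_def
    proof (rule hyp_series_solution[OF assms(1,2) _ rec])
      show "\<alpha> j \<noteq> 0"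
        using \<alpha>[of j] Q assms(7) by auto
      show "\<phi> j (complex_of_real q * z) = \<alpha> j * \<phi> j z" for z
        using \<phi> unfolding Q_def .
      show "(1 - \<alpha> j) *s (complex_of_real q *s Phi21_coeff (\<alpha> j) A B C q (v j) 0
          - \<alpha> j *s (C *v Phi21_coeff (\<alpha> j) A B C q (v j) 0)) = 0"
        using assms(7,9) by (auto simp: Phi21_coeff_0 \<alpha>_def v_def Q_def split: sum.split)
    qed
  next
    fix x :: "'n + 'n \<Rightarrow> complex"
    assume "(\<Sum>j\<in>UNIV. x j *s v j) = 0" and "(\<Sum>j\<in>UNIV. (x j * \<alpha> j) *s v j) = 0"
    then have s1: "(\<Sum>i\<in>UNIV. x (Inl i) *s e i) + (\<Sum>i\<in>UNIV. x (Inr i) *s f i) = 0"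
      and s2: "(\<Sum>i\<in>UNIV. x (Inl i) *s e i) + (\<Sum>i\<in>UNIV. (x (Inr i) * (Q / c i)) *s f i) = 0"
      unfolding UNIV_Plus_UNIV[symmetric]
      by (simp_all add: sum.Plus v_def \<alpha>_def del: UNIV_Plus_UNIV)
    \<comment> \<open>Subtracting the block rows eliminates the \<open>e i\<close> and leaves the factors \<open>1 - Q / c i\<close>.\<close>
    have "(\<Sum>i\<in>UNIV. (x (Inr i) * (1 - Q / c i)) *s f i)
        = (\<Sum>i\<in>UNIV. x (Inr i) *s f i) - (\<Sum>i\<in>UNIV. (x (Inr i) * (Q / c i)) *s f i)"
      by (simp add: vec_eq_iff algebra_simps flip: sum_subtractf)
    also have "\<dots> = 0"
      using add_left_imp_eq[OF trans[OF s1 s2[symmetric]]] by simp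
    finally have "\<forall>i\<in>UNIV. x (Inr i) * (1 - Q / c i) = 0"
      by (intro eigenvectors_independent[OF _ _ assms(9,8)] injI) (use assms(6) in auto)
    moreover have "1 - Q / c i \<noteq> 0" for i
      using c_not_power[of i] Q_powers(1)[of 1] assms(7)[of i] by (auto simp: field_simps)
    ultimately have inr: "x (Inr i) = 0" for i
      by auto
    with s1 have e0: "(\<Sum>i\<in>UNIV. x (Inl i) *s e i) = 0"
      by simp
    have e: "inj e" "vec.independent (range e)"
      using assms(12) by (auto simp: is_basis_def)
    have "(\<Sum>w\<in>range e. x (Inl (inv e w)) *s w) = 0"
      using e0 e(1) by (simp add: sum.reindex)
    then have "x (Inl (inv e (e i))) = 0" for i
      using vec.independentD[OF e(2), of "range e" "\<lambda>w. x (Inl (inv e w))" "e i"] by simp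
    then have "x (Inl i) = 0" for i
      using e(1) by simp
    with inr show "\<forall>j. x j = 0"
      by (metis sum.exhaust)
  qed
  have F: "F j z = \<phi> j z *s H j z" if "norm z < 1" for j z
  proof -
    have "Phi21_gen (\<alpha> j) A B C q z *v v j = H j z"
      unfolding H_def
      by (rule Phi21_gen_mult_vec[OF assms(1,2) that]) (fact poch_\<alpha>, fact regular_\<alpha>)
    then show ?thesis
      by (cases j) (simp_all add: F_def \<phi>_def \<alpha>_def v_def Phi21_def Q_def)
  qed
  show ?thesis
    using spans_over_q_periodic_cong[OF assms(1,2) F spans] unfolding F_def .
qed

end
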